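(* Let $A_1,\dots,A_n,A$ be types of $C2$ and $t$ a $\lambda C$-term. Then $x_1:A_1,\dots,x_n:A_n\vdash_{C2}t:A$ if and only if $x_1:A_1^C,\dots,x_n:A_n^C\vdash_{M2}t:A^C$.
   Context: $\lambda C$-terms are terms of the pure $\lambda$-calculus extended with a constant $C$. Types: second-order formulas built from $\perp$ and atomic formulas $R(t_1,\dots,t_k)$ using $\rightarrow,\forall x,\forall X$; $\neg A=A\rightarrow\perp$; equations $u=v:=\forall Y(Y(u)\rightarrow Y(v))$, a fixed set of equations with $a\approx b$ meaning $a=b$ follows from it. $AF2$ typing rules for $\Gamma\vdash t:A$: axiom; $\rightarrow$-intro/elim; $\forall x$-intro ($x$ not free in $\Gamma$)/elim (any term); $\forall X$-intro ($X$ not free in $\Gamma$)/elim (any formula); equational rule. $C2$ = $AF2$ plus the rule $\Gamma\vdash C:\forall X\{\neg\neg X\rightarrow X\}$. $M2$: in addition there are classical predicate variables $X_C$ of each arity; a type ends with $X$ if it is $X(\vec t)$, or $A\rightarrow B$ with $B$ ending with $X$, or $\forall vA$ with $A$ ending with $X$; a classical type ends with $\perp$ or a classical variable; $M2$ = $AF2$ rules plus $\Gamma\vdash C:\forall X_C\{\neg\neg X_C\rightarrow X_C\}$, $\forall X_C$-intro ($X_C$ not free in $\Gamma$) and $\forall X_C$-elim instantiating only by classical types. Classical translation: to each ordinary predicate variable $X$ associate a classical variable $X_C$ of the same arity; $A^C$ is defined by: $D(\vec t)^C=D(\vec t)$ for $D$ a predicate symbol or $\perp$; $X(\vec t)^C=X_C(\vec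 t)$ for $X$ a predicate variable; $(B\rightarrow D)^C=B^C\rightarrow D^C$; $(\forall xB)^C=\forall xB^C$; $(\forall XB)^C=\forall X_CB^C$.
   Formalization: For C2 ⇒ M2, no predicate symbol other than ⊥ may occur in A_1,…,A_n,A; otherwise it is false: for a 0-ary symbol P, C has type ¬¬P→P in C2, but in M2 C has only classical types. M2 ⇒ C2 is stated for all types of C2. *)

theory Defs
  imports Main
begin

section \<open>Languages, first-order terms and formulas\<close>

record ('f, 'p) lang =
  funs :: "('f \<times> nat) set"
  preds :: "('p \<times> nat) set"

datatype 'f tm = Var nat | Fn 'f "'f tm list"

datatype kind = Ordinary | Classical

text \<open>
  Formulas up to renaming of bound variables, in de Bruijn notation. Individual variables form one
  index space. Predicate variables form one index space for each kind and each arity: the atom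
  \<open>PVar \<kappa> n ts\<close> is an occurrence of the \<open>n\<close>-th predicate variable of kind \<open>\<kappa>\<close> and arity
  \<open>length ts\<close>, and \<open>AllP \<kappa> k A\<close> binds the predicate variable with index \<open>0\<close> of kind \<open>\<kappa>\<close> and
  arity \<open>k\<close> in \<open>A\<close>.
\<close>

datatype ('f, syms: 'p) fm =
    Bot
  | Sym 'p "'f tm list"
  | PVar kind nat "'f tm list"
  | Imp "('f, 'p) fm" "('f, 'p) fm"
  | AllI "('f, 'p) fm"
  | AllP kind nat "('f, 'p) fm"

abbreviation Neg :: "('f, 'p) fm \<Rightarrow> ('f, 'p) fm" where
  "Neg A \<equiv> Imp A Bot"

primrec wf_tm :: "('f, 'p) lang \<Rightarrow> 'f tm \<Rightarrow> bool" where
  "wf_tm L (Var n) \<longleftrightarrow> True"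
| "wf_tm L (Fn f ts) \<longleftrightarrow> (f, length ts) \<in> funs L \<and> list_all (wf_tm L) ts"

primrec wf_fm :: "('f, 'p) lang \<Rightarrow> ('f, 'p) fm \<Rightarrow> bool" where
  "wf_fm L Bot \<longleftrightarrow> True"
| "wf_fm L (Sym p ts) \<longleftrightarrow> (p, length ts) \<in> preds L \<and> list_all (wf_tm L) ts"
| "wf_fm L (PVar \<kappa> n ts) \<longleftrightarrow> list_all (wf_tm L) ts"
| "wf_fm L (Imp A B) \<longleftrightarrow> wf_fm L A \<and> wf_fm L B"
| "wf_fm L (AllI A) \<longleftrightarrow> wf_fm L A"
| "wf_fm L (AllP \<kappa> k A) \<longleftrightarrow> wf_fm L A"

primrec ordinary :: "('f, 'p) fm \<Rightarrow> bool" where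
  "ordinary Bot \<longleftrightarrow> True"
| "ordinary (Sym p ts) \<longleftrightarrow> True"
| "ordinary (PVar \<kappa> n ts) \<longleftrightarrow> \<kappa> = Ordinary"
| "ordinary (Imp A B) \<longleftrightarrow> ordinary A \<and> ordinary B"
| "ordinary (AllI A) \<longleftrightarrow> ordinary A"
| "ordinary (AllP \<kappa> k A) \<longleftrightarrow> \<kappa> = Ordinary \<and> ordinary A"

definition M2_types :: "('f, 'p) lang \<Rightarrow> ('f, 'p) fm set" where
  "M2_types L = {A. wf_fm L A}"

definition C2_types :: "('f, 'p) lang \<Rightarrow> ('f, 'p) fm set" where
  "C2_types L = {A. wf_fm L A \<and> ordinary A}"

text \<open>
  The atomic formula a type ends with. Its indices are to be read below the quantifiers that \<open>ending\<close>
  strips, so only its head is meaningful.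
\<close>

primrec ending :: "('f, 'p) fm \<Rightarrow> ('f, 'p) fm" where
  "ending Bot = Bot"
| "ending (Sym p ts) = Sym p ts"
| "ending (PVar \<kappa> n ts) = PVar \<kappa> n ts"
| "ending (Imp A B) = ending B"
| "ending (AllI A) = ending A"
| "ending (AllP \<kappa> k A) = ending A"

definition classical :: "('f, 'p) fm \<Rightarrow> bool" where
  "classical A \<longleftrightarrow> ending A = Bot \<or> (\<exists>n ts. ending A = PVar Classical n ts)"

section \<open>Substitution\<close>

primrec tm_subst :: "(nat \<Rightarrow> 'f tm) \<Rightarrow> 'f tm \<Rightarrow> 'f tm" where
  "tm_subst \<sigma> (Var n) = \<sigma> n"
| "tm_subst \<sigma> (Fn f ts) = Fn f (map (tm_subst \<sigma>) ts)"

definition up :: "(nat \<Rightarrow> 'f tm) \<Rightarrow> nat \<Rightarrow> 'f tm" where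
  "up \<sigma> = case_nat (Var 0) (\<lambda>n. tm_subst (\<lambda>i. Var (Suc i)) (\<sigma> n))"

primrec subst_i :: "(nat \<Rightarrow> 'f tm) \<Rightarrow> ('f, 'p) fm \<Rightarrow> ('f, 'p) fm" where
  "subst_i \<sigma> Bot = Bot"
| "subst_i \<sigma> (Sym p ts) = Sym p (map (tm_subst \<sigma>) ts)"
| "subst_i \<sigma> (PVar \<kappa> n ts) = PVar \<kappa> n (map (tm_subst \<sigma>) ts)"
| "subst_i \<sigma> (Imp A B) = Imp (subst_i \<sigma> A) (subst_i \<sigma> B)"
| "subst_i \<sigma> (AllI A) = AllI (subst_i (up \<sigma>) A)"
| "subst_i \<sigma> (AllP \<kappa> k A) = AllP \<kappa> k (subst_i \<sigma> A)"

definition lift_i :: "('f, 'p) fm \<Rightarrow> ('f, 'p) fm" where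
  "lift_i A = subst_i (\<lambda>i. Var (Suc i)) A"

text \<open>
  \<open>inst ts A\<close> replaces the individual variables with indices \<open>0, \<dots>, length ts - 1\<close> by \<open>ts\<close> and
  removes them from the index space; in particular \<open>inst [u] A\<close> is the \<open>A[u/x]\<close> for a formula
  \<open>AllI A\<close>.
\<close>

definition inst :: "'f tm list \<Rightarrow> ('f, 'p) fm \<Rightarrow> ('f, 'p) fm" where
  "inst ts A = subst_i (\<lambda>i. if i < length ts then ts ! i else Var (i - length ts)) A"

text \<open>
  \<open>lift_p \<kappa> k 0 A\<close> makes room for a new predicate variable with index \<open>0\<close> of kind \<open>\<kappa>\<close> and arity
  \<open>k\<close>, which therefore does not occur free in the result.
\<close>

primrec lift_p :: "kind \<Rightarrow> nat \<Rightarrow> nat \<Rightarrow> ('f, 'p) fm \<Rightarrow> ('f, 'p) fm" where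
  "lift_p \<kappa> k c Bot = Bot"
| "lift_p \<kappa> k c (Sym p ts) = Sym p ts"
| "lift_p \<kappa> k c (PVar \<kappa>' n ts) =
     PVar \<kappa>' (if \<kappa>' = \<kappa> \<and> length ts = k \<and> c \<le> n then Suc n else n) ts"
| "lift_p \<kappa> k c (Imp A B) = Imp (lift_p \<kappa> k c A) (lift_p \<kappa> k c B)"
| "lift_p \<kappa> k c (AllI A) = AllI (lift_p \<kappa> k c A)"
| "lift_p \<kappa> k c (AllP \<kappa>' k' A) =
     AllP \<kappa>' k' (lift_p \<kappa> k (if \<kappa>' = \<kappa> \<and> k' = k then Suc c else c) A)"

text \<open>
  \<open>subst_p \<kappa> k c G A\<close> is \<open>A[G/X(x\<^sub>1, \<dots>, x\<^sub>k)]\<close>, where \<open>X\<close> is the predicate variable with index \<open>c\<close>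
  of kind \<open>\<kappa>\<close> and arity \<open>k\<close>, which is removed from the index space. The individual variables of
  \<open>G\<close> with indices \<open>0, \<dots>, k - 1\<close> are \<open>x\<^sub>1, \<dots>, x\<^sub>k\<close>; its further individual variables are those of
  \<open>A\<close>, raised by \<open>k\<close>.
\<close>

primrec subst_p :: "kind \<Rightarrow> nat \<Rightarrow> nat \<Rightarrow> ('f, 'p) fm \<Rightarrow> ('f, 'p) fm \<Rightarrow> ('f, 'p) fm" where
  "subst_p \<kappa> k c G Bot = Bot"
| "subst_p \<kappa> k c G (Sym p ts) = Sym p ts"
| "subst_p \<kappa> k c G (PVar \<kappa>' n ts) =
     (if \<kappa>' = \<kappa> \<and> length ts = k
      then if n = c then inst ts G else PVar \<kappa>' (if c < n then n - 1 else n) ts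
      else PVar \<kappa>' n ts)"
| "subst_p \<kappa> k c G (Imp A B) = Imp (subst_p \<kappa> k c G A) (subst_p \<kappa> k c G B)"
| "subst_p \<kappa> k c G (AllI A) =
     AllI (subst_p \<kappa> k c (subst_i (\<lambda>i. Var (if i < k then i else Suc i)) G) A)"
| "subst_p \<kappa> k c G (AllP \<kappa>' k' A) =
     AllP \<kappa>' k'
       (subst_p \<kappa> k (if \<kappa>' = \<kappa> \<and> k' = k then Suc c else c) (lift_p \<kappa>' k' 0 G) A)"

section \<open>Equations\<close>

text \<open>
  A set of equations is given by the set of pairs of their two sides, the individual variables of
  an equation being universally quantified. The relation \<open>u \<approx> v\<close> is deducibility of \<open>u = v\<close>
  from these equations.
\<close>

inductive eqv :: "('f, 'p) lang \<Rightarrow> ('f tm \<times> 'f tm) set \<Rightarrow> 'f tm \<Rightarrow> 'f tm \<Rightarrow> bool"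
  for L :: "('f, 'p) lang" and E :: "('f tm \<times> 'f tm) set" where
  eqv_inst: "(u, v) \<in> E \<Longrightarrow> \<forall>i. wf_tm L (\<sigma> i) \<Longrightarrow> eqv L E (tm_subst \<sigma> u) (tm_subst \<sigma> v)"
| eqv_refl: "wf_tm L u \<Longrightarrow> eqv L E u u"
| eqv_sym: "eqv L E u v \<Longrightarrow> eqv L E v u"
| eqv_trans: "eqv L E u v \<Longrightarrow> eqv L E v w \<Longrightarrow> eqv L E u w"
| eqv_cong: "(f, length us) \<in> funs L \<Longrightarrow> list_all2 (eqv L E) us vs \<Longrightarrow> eqv L E (Fn f us) (Fn f vs)"

section \<open>The type systems\<close>

text \<open>\<open>\<lambda>C\<close>-terms in de Bruijn notation; the list \<open>\<Gamma>\<close> declares the variable \<open>LVar i\<close> of type \<open>\<Gamma> ! i\<close>.\<close>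

datatype lterm = LVar nat | LApp lterm lterm | LLam lterm | LC

text \<open>
  In the introduction rules for the quantifiers, shifting \<open>\<Gamma>\<close> expresses that the quantified
  variable is not free in \<open>\<Gamma>\<close>.
\<close>

inductive C2 ::
  "('f, 'p) lang \<Rightarrow> ('f tm \<times> 'f tm) set \<Rightarrow> ('f, 'p) fm list \<Rightarrow> lterm \<Rightarrow> ('f, 'p) fm \<Rightarrow> bool"
  for L :: "('f, 'p) lang" and E :: "('f tm \<times> 'f tm) set" where
  C2_ax: "set \<Gamma> \<subseteq> C2_types L \<Longrightarrow> i < length \<Gamma> \<Longrightarrow> C2 L E \<Gamma> (LVar i) (\<Gamma> ! i)"
| C2_imp_intro: "C2 L E (A # \<Gamma>) t B \<Longrightarrow> C2 L E \<Gamma> (LLam t) (Imp A B)"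
| C2_imp_elim: "C2 L E \<Gamma> t (Imp A B) \<Longrightarrow> C2 L E \<Gamma> u A \<Longrightarrow> C2 L E \<Gamma> (LApp t u) B"
| C2_alli_intro: "C2 L E (map lift_i \<Gamma>) t A \<Longrightarrow> C2 L E \<Gamma> t (AllI A)"
| C2_alli_elim: "C2 L E \<Gamma> t (AllI A) \<Longrightarrow> wf_tm L u \<Longrightarrow> C2 L E \<Gamma> t (inst [u] A)"
| C2_allp_intro: "C2 L E (map (lift_p Ordinary k 0) \<Gamma>) t A \<Longrightarrow> C2 L E \<Gamma> t (AllP Ordinary k A)"
| C2_allp_elim: "C2 L E \<Gamma> t (AllP Ordinary k A) \<Longrightarrow> G \<in> C2_types L \<Longrightarrow>
    C2 L E \<Gamma> t (subst_p Ordinary k 0 G A)"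
| C2_eq: "C2 L E \<Gamma> t (inst [u] A) \<Longrightarrow> eqv L E u v \<Longrightarrow> C2 L E \<Gamma> t (inst [v] A)"
| C2_C: "set \<Gamma> \<subseteq> C2_types L \<Longrightarrow>
    C2 L E \<Gamma> LC (AllP Ordinary 0 (Imp (Neg (Neg (PVar Ordinary 0 []))) (PVar Ordinary 0 [])))"

inductive M2 ::
  "('f, 'p) lang \<Rightarrow> ('f tm \<times> 'f tm) set \<Rightarrow> ('f, 'p) fm list \<Rightarrow> lterm \<Rightarrow> ('f, 'p) fm \<Rightarrow> bool"
  for L :: "('f, 'p) lang" and E :: "('f tm \<times> 'f tm) set" where
  M2_ax: "set \<Gamma> \<subseteq> M2_types L \<Longrightarrow> i < length \<Gamma> \<Longrightarrow> M2 L E \<Gamma> (LVar i) (\<Gamma> ! i)"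
| M2_imp_intro: "M2 L E (A # \<Gamma>) t B \<Longrightarrow> M2 L E \<Gamma> (LLam t) (Imp A B)"
| M2_imp_elim: "M2 L E \<Gamma> t (Imp A B) \<Longrightarrow> M2 L E \<Gamma> u A \<Longrightarrow> M2 L E \<Gamma> (LApp t u) B"
| M2_alli_intro: "M2 L E (map lift_i \<Gamma>) t A \<Longrightarrow> M2 L E \<Gamma> t (AllI A)"
| M2_alli_elim: "M2 L E \<Gamma> t (AllI A) \<Longrightarrow> wf_tm L u \<Longrightarrow> M2 L E \<Gamma> t (inst [u] A)"
| M2_allp_intro: "M2 L E (map (lift_p Ordinary k 0) \<Gamma>) t A \<Longrightarrow> M2 L E \<Gamma> t (AllP Ordinary k A)"
| M2_allp_elim: "M2 L E \<Gamma> t (AllP Ordinary k A) \<Longrightarrow> G \<in> M2_types L \<Longrightarrow>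
    M2 L E \<Gamma> t (subst_p Ordinary k 0 G A)"
| M2_eq: "M2 L E \<Gamma> t (inst [u] A) \<Longrightarrow> eqv L E u v \<Longrightarrow> M2 L E \<Gamma> t (inst [v] A)"
| M2_allc_intro: "M2 L E (map (lift_p Classical k 0) \<Gamma>) t A \<Longrightarrow> M2 L E \<Gamma> t (AllP Classical k A)"
| M2_allc_elim: "M2 L E \<Gamma> t (AllP Classical k A) \<Longrightarrow> G \<in> M2_types L \<Longrightarrow> classical G \<Longrightarrow>
    M2 L E \<Gamma> t (subst_p Classical k 0 G A)"
| M2_C: "set \<Gamma> \<subseteq> M2_types L \<Longrightarrow>
    M2 L E \<Gamma> LC (AllP Classical 0 (Imp (Neg (Neg (PVar Classical 0 []))) (PVar Classical 0 [])))"

section \<open>The classical translation\<close>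

text \<open>
  The classical variable associated with an ordinary one has the same index and arity. The
  translation is meant for types of \<open>C2\<close>, where all predicate variables are ordinary.
\<close>

primrec ctrans :: "('f, 'p) fm \<Rightarrow> ('f, 'p) fm" where
  "ctrans Bot = Bot"
| "ctrans (Sym p ts) = Sym p ts"
| "ctrans (PVar \<kappa> n ts) = PVar Classical n ts"
| "ctrans (Imp A B) = Imp (ctrans A) (ctrans B)"
| "ctrans (AllI A) = AllI (ctrans A)"
| "ctrans (AllP \<kappa> k A) = AllP Classical k (ctrans A)"

section \<open>Predicate symbols\<close>

text \<open>
  In \<open>M2\<close> the constant \<open>C\<close> has only classical types. So if \<open>P\<close> is a predicate symbol, \<open>C\<close> has
  type \<open>\<not>\<not>P \<rightarrow> P\<close> in \<open>C2\<close>, but it does not have the translated (identical) type in \<open>M2\<close>. Therefore the translation preserves typability only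
  for types without predicate symbols (the constant \<open>\<bottom>\<close> is not counted as one).
\<close>

lemma classical_simps [simp]:
  "classical Bot"
  "\<not> classical (Sym p ts)"
  "classical (PVar \<kappa> n ts) \<longleftrightarrow> \<kappa> = Classical"
  "classical (Imp A B) \<longleftrightarrow> classical B"
  "classical (AllI A) \<longleftrightarrow> classical A"
  "classical (AllP \<kappa> k A) \<longleftrightarrow> classical A"
  by (auto simp: classical_def)

lemma classical_subst_i [simp]: "classical (subst_i \<sigma> A) \<longleftrightarrow> classical A"
  by (induction A arbitrary: \<sigma>) auto

lemma classical_lift_p [simp]: "classical (lift_p \<kappa> k c A) \<longleftrightarrow> classical A"
  by (induction A arbitrary: c) auto

lemma classical_subst_p:
  "classical A \<Longrightarrow> \<kappa> = Classical \<longrightarrow> classical G \<Longrightarrow> classical (subst_p \<kappa> k c G A)"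
  by (induction A arbitrary: c G) (auto simp: inst_def)

lemma M2_C_classical: "M2 L E \<Gamma> LC A \<Longrightarrow> classical A"
  by (induction \<Gamma> LC A rule: M2.induct) (auto simp: inst_def intro!: classical_subst_p)

lemma predicate_symbol_separates:
  fixes L :: "('f, 'p) lang"
  assumes "(p, 0) \<in> preds L"
  defines "P \<equiv> Sym p [] :: ('f, 'p) fm"
  shows "C2 L E [] LC (Imp (Neg (Neg P)) P)"
    and "\<not> M2 L E [] LC (ctrans (Imp (Neg (Neg P)) P))"
proof -
  have "C2 L E [] LC (subst_p Ordinary 0 0 P
      (Imp (Neg (Neg (PVar Ordinary 0 []))) (PVar Ordinary 0 [])))"
    by (intro C2_allp_elim C2_C) (use assms in \<open>auto simp: C2_types_def\<close>)
  then show "C2 L E [] LC (Imp (Neg (Neg P)) P)"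
    by (simp add: inst_def P_def)
  show "\<not> M2 L E [] LC (ctrans (Imp (Neg (Neg P)) P))"
    by (auto simp: P_def dest: M2_C_classical)
qed

end

theory Submission
  imports Defs
begin

text \<open>
  Both directions come from translations that give every predicate variable the same kind. Turning
  all variables of an \<open>M2\<close> derivation into ordinary ones yields a \<open>C2\<close> derivation: \<open>C2\<close> puts no
  restriction on instantiation. Conversely, turn all variables of a \<open>C2\<close> derivation into classical
  ones and replace every predicate symbol by \<open>\<bottom>\<close>, also in those intermediate formulas of the
  derivation that do not survive in its conclusion. Then every type is classical, so each
  instantiation is allowed in \<open>M2\<close>. A renaming \<open>\<rho>\<close> of the indices is carried along because the two
  index spaces of the kinds are merged into one.
\<close>

section \<open>Merging the two kinds of predicate variables\<close>

type_synonym renaming = "kind \<Rightarrow> nat \<Rightarrow> nat \<Rightarrow> nat"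

text \<open>A quantifier leaves the indices of the other kind alone, but in the merged index space
  it shifts both kinds of its arity; hence the second \<open>Suc\<close>.\<close>

definition bind :: "kind \<Rightarrow> nat \<Rightarrow> renaming \<Rightarrow> renaming" where
  "bind \<kappa> k \<rho> = (\<lambda>\<kappa>' k' n.
     if k' = k
     then if \<kappa>' = \<kappa> then case_nat 0 (\<lambda>m. Suc (\<rho> \<kappa>' k' m)) n else Suc (\<rho> \<kappa>' k' n)
     else \<rho> \<kappa>' k' n)"

text \<open>\<open>Ordinary\<close> with \<open>False\<close> serves the passage from
  \<open>M2\<close> to \<open>C2\<close>, \<open>Classical\<close> with \<open>True\<close> the
  opposite one.\<close>

primrec recast :: "kind \<Rightarrow> bool \<Rightarrow> renaming \<Rightarrow> ('f, 'p) fm \<Rightarrow> ('f, 'p) fm" where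
  "recast \<kappa>\<^sub>0 s \<rho> Bot = Bot"
| "recast \<kappa>\<^sub>0 s \<rho> (Sym p ts) = (if s then Bot else Sym p ts)"
| "recast \<kappa>\<^sub>0 s \<rho> (PVar \<kappa> n ts) = PVar \<kappa>\<^sub>0 (\<rho> \<kappa> (length ts) n) ts"
| "recast \<kappa>\<^sub>0 s \<rho> (Imp A B) = Imp (recast \<kappa>\<^sub>0 s \<rho> A) (recast \<kappa>\<^sub>0 s \<rho> B)"
| "recast \<kappa>\<^sub>0 s \<rho> (AllI A) = AllI (recast \<kappa>\<^sub>0 s \<rho> A)"
| "recast \<kappa>\<^sub>0 s \<rho> (AllP \<kappa> k A) = AllP \<kappa>\<^sub>0 k (recast \<kappa>\<^sub>0 s (bind \<kappa> k \<rho>) A)"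

lemma wf_recast: "wf_fm L A \<Longrightarrow> wf_fm L (recast \<kappa>\<^sub>0 s \<rho> A)"
  by (induction A arbitrary: \<rho>) auto

lemma ordinary_recast: "ordinary (recast Ordinary s \<rho> A)"
  by (induction A arbitrary: \<rho>) auto

text \<open>Every atom becomes \<open>Bot\<close> or a classical variable, so the ending atom does
  too.\<close>

lemma classical_recast: "classical (recast Classical True \<rho> A)"
  by (induction A arbitrary: \<rho>) auto

lemma recast_subst_i: "recast \<kappa>\<^sub>0 s \<rho> (subst_i \<sigma> A) = subst_i \<sigma> (recast \<kappa>\<^sub>0 s \<rho> A)"
  by (induction A arbitrary: \<sigma> \<rho>) auto

lemma recast_inst: "recast \<kappa>\<^sub>0 s \<rho> (inst ts A) = inst ts (recast \<kappa>\<^sub>0 s \<rho> A)"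
  by (simp add: inst_def recast_subst_i)

lemma recast_lift_i: "recast \<kappa>\<^sub>0 s \<rho> (lift_i A) = lift_i (recast \<kappa>\<^sub>0 s \<rho> A)"
  by (simp add: lift_i_def recast_subst_i)

section \<open>Lifting and substitution of predicate variables\<close>

text \<open>
  In the following two relations, \<open>c\<close> is a position in the index space of one kind and arity, and
  \<open>c'\<close> is the corresponding position in the merged index space.
\<close>

definition lift_rel :: "kind \<Rightarrow> nat \<Rightarrow> nat \<Rightarrow> nat \<Rightarrow> renaming \<Rightarrow> renaming \<Rightarrow> bool" where
  "lift_rel \<kappa> k c c' \<rho> \<rho>' \<longleftrightarrow> (\<forall>\<kappa>' k' n.
     \<rho>' \<kappa>' k' (if \<kappa>' = \<kappa> \<and> k' = k \<and> c \<le> n then Suc n else n) =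
     (if k' = k \<and> c' \<le> \<rho> \<kappa>' k' n then Suc (\<rho> \<kappa>' k' n) else \<rho> \<kappa>' k' n))"

definition subst_rel :: "kind \<Rightarrow> nat \<Rightarrow> nat \<Rightarrow> nat \<Rightarrow> renaming \<Rightarrow> renaming \<Rightarrow> bool" where
  "subst_rel \<kappa> k c c' \<rho> \<rho>' \<longleftrightarrow> \<rho>' \<kappa> k c = c' \<and> (\<forall>\<kappa>' k' n. (\<kappa>', k', n) \<noteq> (\<kappa>, k, c) \<longrightarrow>
     (k' = k \<longrightarrow> \<rho>' \<kappa>' k' n \<noteq> c') \<and>
     \<rho> \<kappa>' k' (if \<kappa>' = \<kappa> \<and> k' = k \<and> c < n then n - 1 else n) =
     (if k' = k \<and> c' < \<rho>' \<kappa>' k' n then \<rho>' \<kappa>' k' n - 1 else \<rho>' \<kappa>' k' n))"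

lemma lift_rel_bind: "lift_rel \<kappa> k 0 0 \<rho> (bind \<kappa> k \<rho>)"
  by (auto simp: lift_rel_def bind_def)

text \<open>Among the variables of arity \<open>k\<close> only the new one gets index 0; all others
  get successors and so avoid it.\<close>

lemma subst_rel_bind: "subst_rel \<kappa> k 0 0 \<rho> (bind \<kappa> k \<rho>)"
  by (auto simp: subst_rel_def bind_def split: nat.split)

lemma bind_cases:
  fixes \<mu> \<kappa> :: kind and l k n :: nat
  obtains (new) "\<mu> = \<kappa>" "l = k" "n = 0"
  | (same) m where "\<mu> = \<kappa>" "l = k" "n = Suc m"
  | (kind) "\<mu> \<noteq> \<kappa>" "l = k"
  | (arity) "l \<noteq> k"
  by (cases n) auto

text \<open>Below a quantifier the source position moves only if kind and arity agree, the merged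
  position as soon as the arity does.\<close>

lemma lift_rel_under:
  assumes "lift_rel \<kappa> k c c' \<rho> \<rho>'"
  shows "lift_rel \<kappa> k (if \<kappa>' = \<kappa> \<and> k' = k then Suc c else c) (if k' = k then Suc c' else c')
    (bind \<kappa>' k' \<rho>) (bind \<kappa>' k' \<rho>')"
  unfolding lift_rel_def
proof (intro allI)
  fix \<mu> l n
  have *: "\<rho>' \<mu> l (if \<mu> = \<kappa> \<and> l = k \<and> c \<le> m then Suc m else m) =
     (if l = k \<and> c' \<le> \<rho> \<mu> l m then Suc (\<rho> \<mu> l m) else \<rho> \<mu> l m)" for m
    using assms by (simp add: lift_rel_def)
  show "bind \<kappa>' k' \<rho>' \<mu> l
      (if \<mu> = \<kappa> \<and> l = k \<and> (if \<kappa>' = \<kappa> \<and> k' = k then Suc c else c) \<le> n then Suc n else n) =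
    (if l = k \<and> (if k' = k then Suc c' else c') \<le> bind \<kappa>' k' \<rho> \<mu> l n
     then Suc (bind \<kappa>' k' \<rho> \<mu> l n) else bind \<kappa>' k' \<rho> \<mu> l n)"
  proof (cases rule: bind_cases[of \<mu> \<kappa>' l k' n])
    case new
    then show ?thesis by (simp add: bind_def)
  next
    case (same m)
    with *[of m] show ?thesis by (auto simp: bind_def split: if_splits)
  next
    case kind
    with *[of n] show ?thesis by (auto simp: bind_def split: if_splits)
  next
    case arity
    with *[of n] show ?thesis by (auto simp: bind_def split: if_splits)
  qed
qed

text \<open>If the arities agree, the other variables still avoid the merged position: the newly
  bound one gets index 0 while that position becomes a successor, and older ones are shifted along
  with it.\<close>

lemma subst_rel_under:
  assumes "subst_rel \<kappa> k c c' \<rho> \<rho>'"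
  shows "subst_rel \<kappa> k (if \<kappa>' = \<kappa> \<and> k' = k then Suc c else c) (if k' = k then Suc c' else c')
    (bind \<kappa>' k' \<rho>) (bind \<kappa>' k' \<rho>')"
  unfolding subst_rel_def
proof (intro conjI[of "_ = _"] allI impI)
  show "bind \<kappa>' k' \<rho>' \<kappa> k (if \<kappa>' = \<kappa> \<and> k' = k then Suc c else c) = (if k' = k then Suc c' else c')"
    using assms by (auto simp: subst_rel_def bind_def)
next
  fix \<mu> l n
  assume ne: "(\<mu>, l, n) \<noteq> (\<kappa>, k, if \<kappa>' = \<kappa> \<and> k' = k then Suc c else c)"
  have *: "(l = k \<longrightarrow> \<rho>' \<mu> l m \<noteq> c') \<and>
     \<rho> \<mu> l (if \<mu> = \<kappa> \<and> l = k \<and> c < m then m - 1 else m) =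
     (if l = k \<and> c' < \<rho>' \<mu> l m then \<rho>' \<mu> l m - 1 else \<rho>' \<mu> l m)"
    if "(\<mu>, l, m) \<noteq> (\<kappa>, k, c)" for m
    using assms that unfolding subst_rel_def by blast
  show "(l = k \<longrightarrow> bind \<kappa>' k' \<rho>' \<mu> l n \<noteq> (if k' = k then Suc c' else c')) \<and>
    bind \<kappa>' k' \<rho> \<mu> l
      (if \<mu> = \<kappa> \<and> l = k \<and> (if \<kappa>' = \<kappa> \<and> k' = k then Suc c else c) < n then n - 1 else n) =
    (if l = k \<and> (if k' = k then Suc c' else c') < bind \<kappa>' k' \<rho>' \<mu> l n
     then bind \<kappa>' k' \<rho>' \<mu> l n - 1 else bind \<kappa>' k' \<rho>' \<mu> l n)"
  proof (cases rule: bind_cases[of \<mu> \<kappa>' l k' n])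
    case new
    then show ?thesis by (simp add: bind_def)
  next
    case (same m)
    then have "(\<mu>, l, m) \<noteq> (\<kappa>, k, c)" using ne by auto
    \<comment> \<open>Here \<open>n - 1\<close> is \<open>m\<close>, on which \<open>bind\<close>
      again distinguishes cases; if the removed index lies below \<open>n\<close>, then
      \<open>m\<close> is itself a successor.\<close>
    from *[OF this] same show ?thesis
      by (cases m) (auto simp: bind_def split: if_splits nat.splits)
  next
    case kind
    then have "(\<mu>, l, n) \<noteq> (\<kappa>, k, c)" using ne by auto
    from *[OF this] kind show ?thesis by (auto simp: bind_def split: if_splits)
  next
    case arity
    then have "(\<mu>, l, n) \<noteq> (\<kappa>, k, c)" using ne by auto
    from *[OF this] arity show ?thesis by (auto simp: bind_def split: if_splits)
  qed
qed

text \<open>The relation states exactly the variable case. Positions and renamings are general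
  because a quantifier changes them.\<close>

lemma recast_lift_p_rel:
  "lift_rel \<kappa> k c c' \<rho> \<rho>' \<Longrightarrow>
   recast \<kappa>\<^sub>0 s \<rho>' (lift_p \<kappa> k c A) = lift_p \<kappa>\<^sub>0 k c' (recast \<kappa>\<^sub>0 s \<rho> A)"
proof (induction A arbitrary: c c' \<rho> \<rho>')
  case (PVar \<kappa>' n ts)
  then show ?case by (simp add: lift_rel_def)
next
  case (AllP \<kappa>' k' A)
  from AllP.IH[OF lift_rel_under[OF AllP.prems, of \<kappa>' k']] show ?case by simp
qed auto

lemma recast_lift_p:
  "recast \<kappa>\<^sub>0 s (bind \<kappa> k \<rho>) (lift_p \<kappa> k 0 A) = lift_p \<kappa>\<^sub>0 k 0 (recast \<kappa>\<^sub>0 s \<rho> A)"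
  by (rule recast_lift_p_rel[OF lift_rel_bind])

text \<open>\<open>\<rho>'\<close> reads the body, where the substituted variable still exists, and
  \<open>\<rho>\<close> reads \<open>G\<close> and the result. No other variable of that arity is
  sent to \<open>c'\<close>, so merging cannot make the substitution hit a foreign atom.\<close>

lemma recast_subst_p_rel:
  "subst_rel \<kappa> k c c' \<rho> \<rho>' \<Longrightarrow>
   recast \<kappa>\<^sub>0 s \<rho> (subst_p \<kappa> k c G A) =
   subst_p \<kappa>\<^sub>0 k c' (recast \<kappa>\<^sub>0 s \<rho> G) (recast \<kappa>\<^sub>0 s \<rho>' A)"
proof (induction A arbitrary: c c' \<rho> \<rho>' G)
  case (PVar \<kappa>' n ts)
  show ?case
  proof (cases "(\<kappa>', length ts, n) = (\<kappa>, k, c)")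
    case True
    then show ?thesis using PVar by (auto simp: subst_rel_def recast_inst)
  next
    case False
    with PVar have "(length ts = k \<longrightarrow> \<rho>' \<kappa>' (length ts) n \<noteq> c') \<and>
      \<rho> \<kappa>' (length ts) (if \<kappa>' = \<kappa> \<and> length ts = k \<and> c < n then n - 1 else n) =
      (if length ts = k \<and> c' < \<rho>' \<kappa>' (length ts) n
       then \<rho>' \<kappa>' (length ts) n - 1 else \<rho>' \<kappa>' (length ts) n)"
      unfolding subst_rel_def by blast
    with False show ?thesis by auto
  qed
next
  case (AllP \<kappa>' k' A)
  \<comment> \<open>\<open>G\<close> enters the scope lifted, and its recast under
    \<open>bind\<close> is the lifted recast.\<close>
  from AllP.IH[OF subst_rel_under[OF AllP.prems, of \<kappa>' k'], of "lift_p \<kappa>' k' 0 G"]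
  show ?case by (simp add: recast_lift_p)
qed (auto simp: recast_subst_i)

lemma recast_subst_p:
  "recast \<kappa>\<^sub>0 s \<rho> (subst_p \<kappa> k 0 G A) =
   subst_p \<kappa>\<^sub>0 k 0 (recast \<kappa>\<^sub>0 s \<rho> G) (recast \<kappa>\<^sub>0 s (bind \<kappa> k \<rho>) A)"
  by (rule recast_subst_p_rel[OF subst_rel_bind])

section \<open>Recasting derivations\<close>

lemma map_recast_lift_i:
  "map (recast \<kappa>\<^sub>0 s \<rho>) (map lift_i \<Gamma>) = map lift_i (map (recast \<kappa>\<^sub>0 s \<rho>) \<Gamma>)"
  by (simp add: recast_lift_i)

lemma map_recast_lift_p:
  "map (recast \<kappa>\<^sub>0 s (bind \<kappa> k \<rho>)) (map (lift_p \<kappa> k 0) \<Gamma>) =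
   map (lift_p \<kappa>\<^sub>0 k 0) (map (recast \<kappa>\<^sub>0 s \<rho>) \<Gamma>)"
  by (simp add: recast_lift_p)

lemma recast_C2_types: "A \<in> M2_types L \<Longrightarrow> recast Ordinary s \<rho> A \<in> C2_types L"
  by (simp add: C2_types_def M2_types_def wf_recast ordinary_recast)

lemma recast_M2_types: "A \<in> C2_types L \<Longrightarrow> recast \<kappa>\<^sub>0 s \<rho> A \<in> M2_types L"
  by (simp add: C2_types_def M2_types_def wf_recast)

text \<open>Each rule goes to its \<open>C2\<close> counterpart, both predicate quantifiers to the
  ordinary one. The renaming is arbitrary since the introduction rules use the hypothesis at
  \<open>bind\<close>.\<close>

lemma M2_imp_C2:
  "M2 L E \<Gamma> t A \<Longrightarrow> C2 L E (map (recast Ordinary False \<rho>) \<Gamma>) t (recast Ordinary False \<rho> A)"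
proof (induction arbitrary: \<rho> rule: M2.induct)
  case (M2_ax \<Gamma> i)
  then have "set (map (recast Ordinary False \<rho>) \<Gamma>) \<subseteq> C2_types L"
    by (auto intro: recast_C2_types)
  from C2_ax[OF this, of i] M2_ax show ?case by simp
next
  case (M2_imp_intro A \<Gamma> t B)
  then show ?case by (auto intro: C2_imp_intro)
next
  case (M2_imp_elim \<Gamma> t A B u)
  then show ?case by (auto intro: C2_imp_elim)
next
  case (M2_alli_intro \<Gamma> t A)
  from M2_alli_intro.IH[of \<rho>] show ?case
    unfolding map_recast_lift_i by (simp del: map_map add: C2_alli_intro)
next
  case (M2_alli_elim \<Gamma> t A u)
  from C2_alli_elim[OF M2_alli_elim.IH[unfolded recast.simps] \<open>wf_tm L u\<close>] show ?case
    by (simp add: recast_inst)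
next
  case (M2_allp_intro k \<Gamma> t A)
  from M2_allp_intro.IH[of "bind Ordinary k \<rho>"] show ?case
    unfolding map_recast_lift_p by (simp del: map_map add: C2_allp_intro)
next
  case (M2_allp_elim \<Gamma> t k A G)
  from C2_allp_elim[OF M2_allp_elim.IH[unfolded recast.simps]
      recast_C2_types[OF \<open>G \<in> M2_types L\<close>]]
  show ?case by (simp add: recast_subst_p)
next
  case (M2_eq \<Gamma> t u A v)
  from C2_eq[OF M2_eq.IH[unfolded recast_inst] \<open>eqv L E u v\<close>] show ?case
    by (simp add: recast_inst)
next
  case (M2_allc_intro k \<Gamma> t A)
  from M2_allc_intro.IH[of "bind Classical k \<rho>"] show ?case
    unfolding map_recast_lift_p by (simp del: map_map add: C2_allp_intro)
next
  case (M2_allc_elim \<Gamma> t k A G)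
  from C2_allp_elim[OF M2_allc_elim.IH[unfolded recast.simps]
      recast_C2_types[OF \<open>G \<in> M2_types L\<close>]]
  show ?case by (simp add: recast_subst_p)
next
  case (M2_C \<Gamma>)
  then have "set (map (recast Ordinary False \<rho>) \<Gamma>) \<subseteq> C2_types L"
    by (auto intro: recast_C2_types)
  \<comment> \<open>\<open>bind\<close> gives the bound variable index 0, so the recast type of
    \<open>C\<close> is literally the one in the rule.\<close>
  from C2_C[OF this] show ?case by (simp add: bind_def)
qed

text \<open>With symbols erased, every instance \<open>G\<close> becomes a classical type, as
  elimination of a classical quantifier demands.\<close>

lemma C2_imp_M2:
  "C2 L E \<Gamma> t A \<Longrightarrow> M2 L E (map (recast Classical True \<rho>) \<Gamma>) t (recast Classical True \<rho> A)"
proof (induction arbitrary: \<rho> rule: C2.induct)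
  case (C2_ax \<Gamma> i)
  then have "set (map (recast Classical True \<rho>) \<Gamma>) \<subseteq> M2_types L"
    by (auto intro: recast_M2_types)
  from M2_ax[OF this, of i] C2_ax show ?case by simp
next
  case (C2_imp_intro A \<Gamma> t B)
  then show ?case by (auto intro: M2_imp_intro)
next
  case (C2_imp_elim \<Gamma> t A B u)
  then show ?case by (auto intro: M2_imp_elim)
next
  case (C2_alli_intro \<Gamma> t A)
  from C2_alli_intro.IH[of \<rho>] show ?case
    unfolding map_recast_lift_i by (simp del: map_map add: M2_alli_intro)
next
  case (C2_alli_elim \<Gamma> t A u)
  from M2_alli_elim[OF C2_alli_elim.IH[unfolded recast.simps] \<open>wf_tm L u\<close>] show ?case
    by (simp add: recast_inst)
next
  case (C2_allp_intro k \<Gamma> t A)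
  from C2_allp_intro.IH[of "bind Ordinary k \<rho>"] show ?case
    unfolding map_recast_lift_p by (simp del: map_map add: M2_allc_intro)
next
  case (C2_allp_elim \<Gamma> t k A G)
  from M2_allc_elim[OF C2_allp_elim.IH[unfolded recast.simps]
      recast_M2_types[OF \<open>G \<in> C2_types L\<close>] classical_recast]
  show ?case by (simp add: recast_subst_p)
next
  case (C2_eq \<Gamma> t u A v)
  from M2_eq[OF C2_eq.IH[unfolded recast_inst] \<open>eqv L E u v\<close>] show ?case
    by (simp add: recast_inst)
next
  case (C2_C \<Gamma>)
  then have "set (map (recast Classical True \<rho>) \<Gamma>) \<subseteq> M2_types L"
    by (auto intro: recast_M2_types)
  from M2_C[OF this] show ?case by (simp add: bind_def)
qed

section \<open>Recasting against the classical translation\<close>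

text \<open>After translation all variables are classical, and \<open>bind Classical\<close>
  preserves the identity on that kind.\<close>

lemma recast_ctrans:
  "ordinary A \<Longrightarrow> (\<And>k n. \<rho> Classical k n = n) \<Longrightarrow> recast Ordinary False \<rho> (ctrans A) = A"
  by (induction A arbitrary: \<rho>) (auto simp: bind_def split: nat.split)

text \<open>Without symbols there is nothing to erase, and only the change of kind remains.\<close>

lemma recast_eq_ctrans:
  "ordinary A \<Longrightarrow> syms A = {} \<Longrightarrow> (\<And>k n. \<rho> Ordinary k n = n) \<Longrightarrow>
   recast Classical True \<rho> A = ctrans A"
  by (induction A arbitrary: \<rho>) (auto simp: bind_def split: nat.split)

theorem theorem4p2:
  fixes L :: "('f, 'p) lang"
    and E :: "('f tm \<times> 'f tm) set"
    and \<Gamma> :: "('f, 'p) fm list"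
    and A :: "('f, 'p) fm"
    and t :: lterm
  assumes "\<forall>(u, v) \<in> E. wf_tm L u \<and> wf_tm L v"
    and "set \<Gamma> \<subseteq> C2_types L"
    and "A \<in> C2_types L"
  shows "((\<forall>B \<in> set (A # \<Gamma>). syms B = {}) \<longrightarrow>
            (C2 L E \<Gamma> t A \<longleftrightarrow> M2 L E (map ctrans \<Gamma>) t (ctrans A)))
         \<and> (M2 L E (map ctrans \<Gamma>) t (ctrans A) \<longrightarrow> C2 L E \<Gamma> t A)"
proof -
  \<comment> \<open>The given types have variables of one kind only, so no free variables get merged
    and the identity restores their indices.\<close>
  define \<rho> :: renaming where "\<rho> = (\<lambda>\<kappa> k n. n)"
  have ord: "ordinary B" if "B \<in> set (A # \<Gamma>)" for B
    using that assms by (auto simp: C2_types_def)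
  have M2_C2: "C2 L E \<Gamma> t A" if "M2 L E (map ctrans \<Gamma>) t (ctrans A)"
  proof -
    \<comment> \<open>The end judgement returns to itself, whichever kinds the derivation uses in
      between.\<close>
    have "recast Ordinary False \<rho> (ctrans B) = B" if "B \<in> set (A # \<Gamma>)" for B
      using ord[OF that] by (simp add: recast_ctrans \<rho>_def)
    then have "map (recast Ordinary False \<rho>) (map ctrans \<Gamma>) = \<Gamma>"
      and "recast Ordinary False \<rho> (ctrans A) = A"
      by (simp_all add: map_idI)
    with M2_imp_C2[OF that, of \<rho>] show ?thesis by (simp del: map_map)
  qed
  have C2_M2: "M2 L E (map ctrans \<Gamma>) t (ctrans A)"
    if "C2 L E \<Gamma> t A" and free: "\<forall>B \<in> set (A # \<Gamma>). syms B = {}"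
  proof -
    \<comment> \<open>Symbols used inside the derivation disappear, while the end judgement has none
      to lose.\<close>
    have "recast Classical True \<rho> B = ctrans B" if "B \<in> set (A # \<Gamma>)" for B
      using ord[OF that] bspec[OF free that] by (simp add: recast_eq_ctrans \<rho>_def)
    then have "map (recast Classical True \<rho>) \<Gamma> = map ctrans \<Gamma>"
      and "recast Classical True \<rho> A = ctrans A"
      by simp_all
    with C2_imp_M2[OF \<open>C2 L E \<Gamma> t A\<close>, of \<rho>] show ?thesis by simp
  qed
  show ?thesis using M2_C2 C2_M2 by blast
qed

end
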